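(* Let $v,w\in S_n$ with $I(v)=(x_1,\ldots,x_n)$ and $I(w)=(y_1,\ldots,y_n)$. In the middle order lattice $\mathcal{P}_n$, the relative pseudocomplement satisfies $I(v\rightsquigarrow w)=(z_1,\ldots,z_n)$ where $z_i=i-1$ if $x_i\le y_i$ and $z_i=y_i$ if $x_i>y_i$. As a consequence, the pseudocomplement $\sim v$ is the $132$- and $231$-avoiding permutation obtained by listing the right-to-left minima of $v$ in decreasing order, followed by all the remaining values in increasing order. Finally, $v$ is regular if and only if $v$ avoids both $132$ and $231$.
   Context: For $w\in S_n$ (one-line notation), its inversion sequence is $I(w)=(x_1,\ldots,x_n)$ with $x_i=\#\{j<i : w^{-1}(j)>w^{-1}(i)\}$; $w\mapsto I(w)$ is a bijection onto sequences with $x_i\in[0,i-1]$. The middle order $\mathcal{P}_n$ is the lattice on $S_n$ with $v\le w$ iff $I(v)\le I(w)$ coordinate-wise; meet and join are coordinate-wise min and max of inversion sequences, and its minimum is the identity $e_n$. The relative pseudocomplement is $v\rightsquigarrow w=\max\{z\in\mathcal{P}_n : v\wedge z\le w\}$, the pseudocomplement is $\sim v=v\rightsquigarrow e_n$, and $v$ is regular if $v=\sim\sim v$. A right-to-left minimum of $v$ is a value $i$ such that no smaller value appears to its right in $v$. A permutation avoids $132$ (resp. $231$) if it has no indices $i<j<k$ with $w(i)<w(k)<w(j)$ (resp. $w(k)<w(i)<w(j)$). *)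

theory Defs
  imports "HOL-Algebra.Lattice" "HOL-Combinatorics.Permutations"
begin

text \<open>
  Elements of $S_n$ are functions \<open>w\<close> with \<open>w permutes {1..n}\<close>, where \<open>w p\<close> is the value at
  position \<open>p\<close>. Indices of inversion sequences are 1-based, so only \<open>inversion_seq w i\<close> with
  \<open>i \<in> {1..n}\<close> is a coordinate of the inversion sequence of \<open>w\<close>.
\<close>

definition one_line :: "nat \<Rightarrow> (nat \<Rightarrow> nat) \<Rightarrow> nat list" where
  "one_line n w = map w [1..<Suc n]"

definition inversion_seq :: "(nat \<Rightarrow> nat) \<Rightarrow> nat \<Rightarrow> nat" where
  "inversion_seq w i = card {j. 1 \<le> j \<and> j < i \<and> inv w j > inv w i}"

definition middle_order :: "nat \<Rightarrow> (nat \<Rightarrow> nat) gorder" where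
  "middle_order n =
    \<lparr> carrier = {w. w permutes {1..n}},
      eq = (=),
      le = (\<lambda>v w. \<forall>i\<in>{1..n}. inversion_seq v i \<le> inversion_seq w i) \<rparr>"

definition rpc_set :: "('a, 'b) gorder_scheme \<Rightarrow> 'a \<Rightarrow> 'a \<Rightarrow> 'a set" where
  "rpc_set L v w = {z \<in> carrier L. v \<sqinter>\<^bsub>L\<^esub> z \<sqsubseteq>\<^bsub>L\<^esub> w}"

definition rel_pseudocomplement :: "('a, 'b) gorder_scheme \<Rightarrow> 'a \<Rightarrow> 'a \<Rightarrow> 'a" where
  "rel_pseudocomplement L v w = (THE z. greatest L z (rpc_set L v w))"

text \<open>The minimum of the middle order is the identity permutation.\<close>

definition pseudocomplement :: "nat \<Rightarrow> (nat \<Rightarrow> nat) \<Rightarrow> (nat \<Rightarrow> nat)" where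
  "pseudocomplement n v = rel_pseudocomplement (middle_order n) v id"

definition regular :: "nat \<Rightarrow> (nat \<Rightarrow> nat) \<Rightarrow> bool" where
  "regular n v \<longleftrightarrow> v = pseudocomplement n (pseudocomplement n v)"

text \<open>Right-to-left minima are values, not positions.\<close>

definition rtl_minima :: "nat \<Rightarrow> (nat \<Rightarrow> nat) \<Rightarrow> nat set" where
  "rtl_minima n v = {v p | p. p \<in> {1..n} \<and> (\<forall>q\<in>{1..n}. p < q \<longrightarrow> \<not> v q < v p)}"

definition avoids_132 :: "nat \<Rightarrow> (nat \<Rightarrow> nat) \<Rightarrow> bool" where
  "avoids_132 n w \<longleftrightarrow>
    \<not> (\<exists>i\<in>{1..n}. \<exists>j\<in>{1..n}. \<exists>k\<in>{1..n}. i < j \<and> j < k \<and> w i < w k \<and> w k < w j)"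

definition avoids_231 :: "nat \<Rightarrow> (nat \<Rightarrow> nat) \<Rightarrow> bool" where
  "avoids_231 n w \<longleftrightarrow>
    \<not> (\<exists>i\<in>{1..n}. \<exists>j\<in>{1..n}. \<exists>k\<in>{1..n}. i < j \<and> j < k \<and> w k < w i \<and> w i < w j)"

end

theory Submission
  imports Defs
begin

text \<open>
  A permutation is determined by its inversion sequence: inserting the values in increasing order,
  the values to the right of the newest one form an up-set of a chain, and an up-set of a finite
  chain is determined by its size. Since there are as many permutations as admissible sequences,
  the middle order is a product of chains, in which meets and relative pseudocomplements are
  computed coordinate-wise. The coordinate at \<open>i\<close> is \<open>0\<close> (resp. \<open>i - 1\<close>) iff all values below \<open>i\<close>
  lie to its left (resp. right); hence avoiding both patterns, i.e. having no \<open>i\<close> with smaller values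
  on both sides, means that every coordinate is extremal.
\<close>

section \<open>Range and extremal values of the coordinates\<close>

lemma inversion_seq_le: "inversion_seq w i \<le> i - 1"
proof -
  have "card {j. 1 \<le> j \<and> j < i \<and> inv w j > inv w i} \<le> card {1..<i}"
    by (rule card_mono) auto
  then show ?thesis by (simp add: inversion_seq_def)
qed

lemma inversion_seq_eq_0_iff:
  "inversion_seq w i = 0 \<longleftrightarrow> (\<forall>j. 1 \<le> j \<and> j < i \<longrightarrow> inv w j \<le> inv w i)"
proof -
  have "finite {j. 1 \<le> j \<and> j < i \<and> inv w j > inv w i}"
    by (rule finite_subset[of _ "{1..<i}"]) auto
  then show ?thesis by (auto simp: inversion_seq_def not_less)
qed

lemma inversion_seq_eq_max_iff:
  "inversion_seq w i = i - 1 \<longleftrightarrow> (\<forall>j. 1 \<le> j \<and> j < i \<longrightarrow> inv w i < inv w j)"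
proof -
  let ?A = "{j. 1 \<le> j \<and> j < i \<and> inv w j > inv w i}"
  have sub: "?A \<subseteq> {1..<i}" by auto
  have "inversion_seq w i = i - 1 \<longleftrightarrow> card ?A = card {1..<i}"
    by (simp add: inversion_seq_def)
  also have "\<dots> \<longleftrightarrow> ?A = {1..<i}"
    by (rule iffI[OF card_subset_eq[OF finite_atLeastLessThan sub] arg_cong])
  finally show ?thesis unfolding set_eq_iff mem_Collect_eq atLeastLessThan_iff by blast
qed

lemma inversion_seq_id: "inversion_seq id i = 0"
  by (simp add: inversion_seq_eq_0_iff)

section \<open>Injectivity of the inversion sequence\<close>

lemma permutes_inv_less_iff_le:
  assumes "w permutes S" "i \<noteq> j"
  shows "inv w i < inv w j \<longleftrightarrow> inv w i \<le> (inv w j :: nat)"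
  using assms permutes_inj[OF permutes_inv[OF assms(1)]] by (auto simp: inj_def le_less)

text \<open>The first \<open>m\<close> coordinates fix only the relative order of the values up to
  \<open>m\<close>, not their positions, so the induction runs on comparisons of positions.\<close>

lemma same_inversion_seq_same_order:
  assumes v: "v permutes {1..n}" and w: "w permutes {1..n}"
    and eq: "\<And>i. i \<in> {1..n} \<Longrightarrow> inversion_seq v i = inversion_seq w i"
  shows "m \<le> n \<Longrightarrow> \<forall>i\<in>{1..m}. \<forall>j\<in>{1..m}. inv v i < inv v j \<longleftrightarrow> inv w i < inv w j"
proof (induction m)
  case 0
  then show ?case by simp
next
  case (Suc m)
  let ?A = "\<lambda>u. {j. 1 \<le> j \<and> j < Suc m \<and> inv u j > inv u (Suc m)}"
  have fin: "finite (?A u)" for u :: "nat \<Rightarrow> nat"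
    by (rule finite_subset[of _ "{1..m}"]) auto
  have IH: "inv v i < inv v j \<longleftrightarrow> inv w i < inv w j" if "i \<in> {1..m}" "j \<in> {1..m}" for i j
    using Suc that by simp
  have card: "card (?A v) = card (?A w)"
    using eq[of "Suc m"] Suc.prems by (simp add: inversion_seq_def)
  \<comment> \<open>Both sets are up-sets of \<open>{1..m}\<close> under the position order, which
    \<open>IH\<close> makes the same for \<open>v\<close> and \<open>w\<close>. Witnesses
    \<open>a\<close>, \<open>b\<close> of incomparability would be ordered oppositely by
    \<open>v\<close> and \<open>w\<close>.\<close>
  have "?A v \<subseteq> ?A w \<or> ?A w \<subseteq> ?A v"
  proof (rule ccontr)
    assume "\<not> ?thesis"
    then obtain a b where "a \<in> ?A v" "a \<notin> ?A w" "b \<in> ?A w" "b \<notin> ?A v" by blast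
    then have ab: "a \<in> {1..m}" "b \<in> {1..m}"
      "inv v a > inv v (Suc m)" "\<not> inv w a > inv w (Suc m)"
      "inv w b > inv w (Suc m)" "\<not> inv v b > inv v (Suc m)" by auto
    then have "inv v b < inv v a" "inv w a < inv w b" by auto
    then show False using IH[of b a] ab by simp
  qed
  then have "?A v = ?A w"
  proof
    assume "?A v \<subseteq> ?A w"
    from card_subset_eq[OF fin this card] show ?thesis .
  next
    assume "?A w \<subseteq> ?A v"
    from card_subset_eq[OF fin this card[symmetric]] show ?thesis by (rule sym)
  qed
  then have mem: "j \<in> ?A v \<longleftrightarrow> j \<in> ?A w" for j by (simp only:)
  have new: "inv v (Suc m) < inv v j \<longleftrightarrow> inv w (Suc m) < inv w j" if "j \<in> {1..m}" for j
    using mem[of j] that by (simp add: less_Suc_eq_le)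
  \<comment> \<open>The sets record only what lies to the right of \<open>Suc m\<close>. Distinct
    values have distinct positions, so not being to the right means being strictly to the
    left.\<close>
  have new': "inv v j < inv v (Suc m) \<longleftrightarrow> inv w j < inv w (Suc m)" if "j \<in> {1..m}" for j
  proof -
    have "j \<noteq> Suc m" using that by simp
    then show ?thesis
      using new[OF that] permutes_inv_less_iff_le[OF v, of j "Suc m"]
        permutes_inv_less_iff_le[OF w, of j "Suc m"] by linarith
  qed
  show ?case using IH new new' by (auto simp: atLeastAtMostSuc_conv)
qed

text \<open>The values below \<open>p i\<close> fill \<open>{1..<p i}\<close>, and \<open>p\<close>
  is injective. Applied to inverses, this turns comparisons of positions back into the positions
  themselves.\<close>

lemma permutes_eq_card_less:
  assumes p: "p permutes {1..n}" and i: "i \<in> {1..n}"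
  shows "p i = Suc (card {j \<in> {1..n}. p j < p i})"
proof -
  have "p ` {j \<in> {1..n}. p j < p i} = {k \<in> p ` {1..n}. k < p i}" by auto
  also have "\<dots> = {1..<p i}"
    using permutes_image[OF p] permutes_in_image[OF p, of i] i by auto
  finally have "card {j \<in> {1..n}. p j < p i} = card {1..<p i}"
    using card_image[OF inj_on_subset[OF permutes_inj[OF p] subset_UNIV]] by metis
  moreover have "1 \<le> p i" using permutes_in_image[OF p, of i] i by simp
  ultimately show ?thesis by simp
qed

lemma inversion_seq_inject:
  assumes v: "v permutes {1..n}" and w: "w permutes {1..n}"
    and eq: "\<And>i. i \<in> {1..n} \<Longrightarrow> inversion_seq v i = inversion_seq w i"
  shows "v = w"
proof -
  have "inv v i = inv w i" for i
  proof (cases "i \<in> {1..n}")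
    case True
    have "{j \<in> {1..n}. inv v j < inv v i} = {j \<in> {1..n}. inv w j < inv w i}"
      using same_inversion_seq_same_order[OF v w eq order_refl] True by blast
    then show ?thesis
      using permutes_eq_card_less[OF permutes_inv[OF v] True]
        permutes_eq_card_less[OF permutes_inv[OF w] True] by simp
  next
    case False
    then show ?thesis using permutes_not_in[OF permutes_inv] v w by metis
  qed
  then have "inv v = inv w" by auto
  then show ?thesis using permutes_inv_inv v w by metis
qed

section \<open>Surjectivity by counting\<close>

lemma ex_inversion_seq:
  assumes x: "\<And>i. i \<in> {1..n} \<Longrightarrow> x i \<le> i - 1"
  obtains w where "w permutes {1..n}" "\<And>i. i \<in> {1..n} \<Longrightarrow> inversion_seq w i = x i"
proof -
  \<comment> \<open>The factor \<open>{..<i}\<close> has \<open>i\<close> elements, so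
    \<open>?T\<close> has \<open>fact n\<close> elements, as many as \<open>?P\<close>. Restriction
    makes the coordinates a member of this extensional product.\<close>
  let ?P = "{w. w permutes {1..n}}" and ?T = "Pi\<^sub>E {1..n} (\<lambda>i. {..<i})"
  let ?I = "\<lambda>w. restrict (inversion_seq w) {1..n}"
  have inj: "inj_on ?I ?P"
  proof (rule inj_onI)
    fix v w assume vw: "v \<in> ?P" "w \<in> ?P" and "?I v = ?I w"
    then have "inversion_seq v i = inversion_seq w i" if "i \<in> {1..n}" for i
      using that restrict_apply' by metis
    then show "v = w" using vw inversion_seq_inject by blast
  qed
  have "inversion_seq w i < i" if "i \<in> {1..n}" for w i
    using inversion_seq_le[of w i] that by auto
  then have sub: "?I ` ?P \<subseteq> ?T" by auto
  have "card ?T = (\<Prod>i\<in>{1..n}. i)" by (simp add: card_PiE)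
  moreover have "card ?P = fact n" by (rule card_permutations) simp_all
  ultimately have "card (?I ` ?P) = card ?T"
    by (simp add: card_image[OF inj] fact_prod del: One_nat_def)
  then have "?I ` ?P = ?T"
    by (intro card_subset_eq sub finite_PiE) auto
  moreover have "x i < i" if "i \<in> {1..n}" for i using x[OF that] that by auto
  then have "restrict x {1..n} \<in> ?T" by auto
  ultimately have "restrict x {1..n} \<in> ?I ` ?P" by (simp only:)
  then obtain w where "w permutes {1..n}" "restrict x {1..n} = ?I w" by blast
  then show ?thesis using that restrict_apply' by metis
qed

section \<open>Meets and relative pseudocomplements in the middle order\<close>

lemma carrier_middle_order: "w \<in> carrier (middle_order n) \<longleftrightarrow> w permutes {1..n}"
  by (simp add: middle_order_def)

lemma le_middle_order:
  "v \<sqsubseteq>\<^bsub>middle_order n\<^esub> w \<longleftrightarrow> (\<forall>i\<in>{1..n}. inversion_seq v i \<le> inversion_seq w i)"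
  by (simp add: middle_order_def)

lemma middle_order_antisym:
  assumes "v permutes {1..n}" "w permutes {1..n}"
    and "v \<sqsubseteq>\<^bsub>middle_order n\<^esub> w" "w \<sqsubseteq>\<^bsub>middle_order n\<^esub> v"
  shows "v = w"
  using assms by (intro inversion_seq_inject) (auto simp: le_middle_order intro: antisym)

text \<open>Identifies the elements chosen by \<open>SOME\<close> in the meet and by
  \<open>THE\<close> in \<open>rel_pseudocomplement\<close> with explicit witnesses built from their
  coordinates.\<close>

lemma greatest_middle_order_unique:
  assumes a: "greatest (middle_order n) a A" and b: "greatest (middle_order n) b A"
  shows "a = b"
proof (rule middle_order_antisym)
  show "a permutes {1..n}" "b permutes {1..n}"
    using a b carrier_middle_order unfolding greatest_def by blast+
  show "a \<sqsubseteq>\<^bsub>middle_order n\<^esub> b" "b \<sqsubseteq>\<^bsub>middle_order n\<^esub> a"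
    using a b unfolding greatest_def by blast+
qed

lemma inversion_seq_meet:
  assumes v: "v permutes {1..n}" and w: "w permutes {1..n}" and i: "i \<in> {1..n}"
  shows "inversion_seq (v \<sqinter>\<^bsub>middle_order n\<^esub> w) i = min (inversion_seq v i) (inversion_seq w i)"
proof -
  let ?L = "middle_order n"
  have "min (inversion_seq v i) (inversion_seq w i) \<le> i - 1" for i
    using inversion_seq_le[of v i] by linarith
  then obtain m where m: "m permutes {1..n}"
    and Im: "\<And>i. i \<in> {1..n} \<Longrightarrow> inversion_seq m i = min (inversion_seq v i) (inversion_seq w i)"
    using ex_inversion_seq[of n "\<lambda>i. min (inversion_seq v i) (inversion_seq w i)"] by blast
  have gr: "greatest ?L m (Lower ?L {v, w})"
    using v w m Im by (auto simp: greatest_def Lower_def le_middle_order carrier_middle_order)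
  then have "greatest ?L (v \<sqinter>\<^bsub>?L\<^esub> w) (Lower ?L {v, w})"
    unfolding meet_def inf_def by (rule someI[of "\<lambda>g. greatest ?L g (Lower ?L {v, w})"])
  then have "v \<sqinter>\<^bsub>?L\<^esub> w = m"
    using gr by (rule greatest_middle_order_unique)
  then show ?thesis using Im i by simp
qed

lemma rpc_set_middle_order:
  assumes "v permutes {1..n}"
  shows "z \<in> rpc_set (middle_order n) v w \<longleftrightarrow> z permutes {1..n} \<and>
    (\<forall>i\<in>{1..n}. min (inversion_seq v i) (inversion_seq z i) \<le> inversion_seq w i)"
  using assms
  by (auto simp: rpc_set_def carrier_middle_order le_middle_order inversion_seq_meet)

text \<open>In one coordinate the constraint is \<open>min x z \<le> y\<close>. If
  \<open>x \<le> y\<close>, every \<open>z\<close> satisfies it and the top \<open>i - 1\<close> is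
  the largest; if \<open>x > y\<close>, it says \<open>z \<le> y\<close>.\<close>

lemma rel_pseudocomplement_middle_order:
  fixes n v w
  assumes v: "v permutes {1..n}"
  defines "r \<equiv> rel_pseudocomplement (middle_order n) v w"
  shows greatest_rel_pseudocomplement:
      "greatest (middle_order n) r (rpc_set (middle_order n) v w)"
    and rel_pseudocomplement_permutes: "r permutes {1..n}"
    and inversion_seq_rel_pseudocomplement: "i \<in> {1..n} \<Longrightarrow>
      inversion_seq r i =
        (if inversion_seq v i \<le> inversion_seq w i then i - 1 else inversion_seq w i)"
proof -
  let ?L = "middle_order n"
  let ?x = "\<lambda>i. if inversion_seq v i \<le> inversion_seq w i then i - 1 else inversion_seq w i"
  have "?x i \<le> i - 1" for i
    using inversion_seq_le[of w i] by simp
  then obtain z where z: "z permutes {1..n}"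
    and Iz: "\<And>i. i \<in> {1..n} \<Longrightarrow> inversion_seq z i = ?x i"
    using ex_inversion_seq[of n ?x] by blast
  have "z \<in> rpc_set ?L v w"
    using z Iz by (auto simp: rpc_set_middle_order[OF v])
  moreover have "u \<sqsubseteq>\<^bsub>?L\<^esub> z" if "u \<in> rpc_set ?L v w" for u
    using that Iz inversion_seq_le[of u]
    by (fastforce simp: rpc_set_middle_order[OF v] le_middle_order min_def split: if_splits)
  ultimately have gr: "greatest ?L z (rpc_set ?L v w)"
    by (auto simp: greatest_def rpc_set_def)
  have "r = z"
    unfolding r_def rel_pseudocomplement_def
  proof (rule the_equality)
    show "greatest ?L z (rpc_set ?L v w)" by (rule gr)
    fix u assume "greatest ?L u (rpc_set ?L v w)"
    then show "u = z" using gr by (rule greatest_middle_order_unique)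
  qed
  then show "greatest ?L r (rpc_set ?L v w)" "r permutes {1..n}"
    "i \<in> {1..n} \<Longrightarrow> inversion_seq r i = ?x i"
    using gr z Iz by auto
qed

section \<open>Pseudocomplements and pattern avoidance\<close>

lemma pseudocomplement_permutes:
  "v permutes {1..n} \<Longrightarrow> pseudocomplement n v permutes {1..n}"
  unfolding pseudocomplement_def by (rule rel_pseudocomplement_permutes)

lemma inversion_seq_pseudocomplement:
  assumes "v permutes {1..n}" "i \<in> {1..n}"
  shows "inversion_seq (pseudocomplement n v) i = (if inversion_seq v i = 0 then i - 1 else 0)"
  using inversion_seq_rel_pseudocomplement[OF assms, of id]
  by (simp add: pseudocomplement_def inversion_seq_id)

lemma avoids_132_231_iff:
  assumes w: "w permutes {1..n}"
  shows "avoids_132 n w \<and> avoids_231 n w \<longleftrightarrow> (\<forall>i\<in>{1..n}. inversion_seq w i \<in> {0, i - 1})"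
proof (intro iffI ballI)
  fix m assume av: "avoids_132 n w \<and> avoids_231 n w" and m: "m \<in> {1..n}"
  show "inversion_seq w m \<in> {0, m - 1}"
  proof (rule ccontr)
    assume "\<not> ?thesis"
    \<comment> \<open>A nonzero coordinate yields a smaller value \<open>a\<close> to the right of
      \<open>m\<close>; a coordinate below \<open>m - 1\<close> yields a smaller value
      \<open>b\<close> to its left.\<close>
    then obtain a b where ab: "1 \<le> a" "a < m" "inv w m < inv w a"
      "1 \<le> b" "b < m" "inv w b \<le> inv w m"
      using inversion_seq_eq_0_iff[of w m] inversion_seq_eq_max_iff[of w m] by (auto simp: not_less not_le)
    then have "inv w b < inv w m"
      using permutes_inv_less_iff_le[OF w, of b m] by simp
    moreover have "inv w c \<in> {1..n}" if "c \<in> {1..n}" for c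
      using permutes_in_image[OF permutes_inv[OF w]] that by simp
    then have "inv w a \<in> {1..n}" "inv w b \<in> {1..n}" "inv w m \<in> {1..n}"
      using ab m by auto
    moreover have "w (inv w c) = c" for c using permutes_inverses(1)[OF w] .
    \<comment> \<open>The values \<open>b\<close>, \<open>m\<close>, \<open>a\<close> occur in this
      order with \<open>m\<close> largest: \<open>b < a\<close> makes them a 132 pattern and
      \<open>a < b\<close> a 231 pattern.\<close>
    moreover have "a < b \<or> b < a" using ab \<open>inv w b < inv w m\<close> by (metis less_asym nat_neq_iff)
    ultimately show False
      using av ab unfolding avoids_132_def avoids_231_def by metis
  qed
next
  assume ext: "\<forall>i\<in>{1..n}. inversion_seq w i \<in> {0, i - 1}"
  \<comment> \<open>Both patterns have their largest entry in the middle. The smaller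
    \<open>w i\<close> on its left excludes the maximal coordinate at \<open>w j\<close>, and the
    smaller \<open>w k\<close> on its right excludes 0.\<close>
  have no_peak: False if ijk: "i \<in> {1..n}" "j \<in> {1..n}" "k \<in> {1..n}" "i < j" "j < k"
      "w i < w j" "w k < w j" for i j k
  proof -
    have "w c \<in> {1..n}" if "c \<in> {1..n}" for c
      using permutes_in_image[OF w] that by simp
    then have "1 \<le> w i" "w j \<in> {1..n}" "1 \<le> w k" using ijk by auto
    moreover have "inv w (w c) = c" for c using permutes_inverses(2)[OF w] .
    ultimately show False
      using ext inversion_seq_eq_0_iff[of w "w j"] inversion_seq_eq_max_iff[of w "w j"] ijk
      by (metis insert_iff empty_iff less_asym not_less)
  qed
  show "avoids_132 n w \<and> avoids_231 n w"
    unfolding avoids_132_def avoids_231_def by (meson no_peak less_trans)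
qed

section \<open>Right-to-left minima and one-line notation\<close>

lemma rtl_minima_iff:
  assumes v: "v permutes {1..n}"
  shows "i \<in> rtl_minima n v \<longleftrightarrow> i \<in> {1..n} \<and> inversion_seq v i = 0"
proof
  assume "i \<in> rtl_minima n v"
  then obtain p where p: "i = v p" "p \<in> {1..n}" "\<And>q. q \<in> {1..n} \<Longrightarrow> p < q \<Longrightarrow> \<not> v q < v p"
    unfolding rtl_minima_def by auto
  have i: "i \<in> {1..n}" using permutes_in_image[OF v] p by simp
  have "inv v j \<le> inv v i" if "1 \<le> j" "j < i" for j
  proof -
    have "inv v j \<in> {1..n}" using permutes_in_image[OF permutes_inv[OF v], of j] that i by simp
    then show ?thesis
      using p(3)[of "inv v j"] that p(1) permutes_inverses[OF v] by (metis not_less)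
  qed
  then show "i \<in> {1..n} \<and> inversion_seq v i = 0"
    using i by (simp add: inversion_seq_eq_0_iff)
next
  assume i: "i \<in> {1..n} \<and> inversion_seq v i = 0"
  have "\<not> v q < i" if "q \<in> {1..n}" "inv v i < q" for q
  proof
    assume "v q < i"
    moreover have "1 \<le> v q" using permutes_in_image[OF v, of q] that by simp
    ultimately have "inv v (v q) \<le> inv v i" using i by (simp add: inversion_seq_eq_0_iff)
    then show False using that permutes_inverses(2)[OF v] by simp
  qed
  moreover have "inv v i \<in> {1..n}" "v (inv v i) = i"
    using permutes_in_image[OF permutes_inv[OF v], of i] i permutes_inverses(1)[OF v] by auto
  ultimately show "i \<in> rtl_minima n v"
    unfolding rtl_minima_def by (intro CollectI exI[of _ "inv v i"]) auto
qed

text \<open>Both lists are increasing for the key that negates the elements of \<open>M\<close>.\<close>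

lemma one_line_of_extremal_inversion_seq:
  assumes u: "u permutes {1..n}" and M: "M \<subseteq> {1..n}"
    and max: "\<And>i. i \<in> M \<Longrightarrow> inversion_seq u i = i - 1"
    and zero: "\<And>i. i \<in> {1..n} - M \<Longrightarrow> inversion_seq u i = 0"
  shows "one_line n u = rev (sorted_list_of_set M) @ sorted_list_of_set ({1..n} - M)"
proof -
  \<comment> \<open>Values in \<open>{1..n}\<close> are positive, so under \<open>f\<close> the
    elements of \<open>M\<close> come first, in decreasing order, and \<open>f\<close> is injective
    there.\<close>
  define f :: "nat \<Rightarrow> int" where "f i = (if i \<in> M then - int i else int i)" for i
  let ?r = "rev (sorted_list_of_set M) @ sorted_list_of_set ({1..n} - M)"
  have finM: "finite M" using M finite_subset by blast
  have inj: "inj_on f {1..n}"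
    by (auto simp: inj_on_def f_def split: if_splits)
  have step: "f (u p) < f (u q)" if pq: "p \<in> {1..n}" "q \<in> {1..n}" "p < q" for p q
  proof -
    have in_range: "u p \<in> {1..n}" "u q \<in> {1..n}" using permutes_in_image[OF u] pq by simp_all
    have inv_u: "inv u (u c) = c" for c using permutes_inverses(2)[OF u] .
    have "u p \<noteq> u q" using inv_u pq by (metis less_irrefl)
    have inv_less: "inv u (u p) < inv u (u q)" using inv_u pq by simp
    have ge_1: "1 \<le> u p" "1 \<le> u q" using in_range by simp_all
    \<comment> \<open>The larger value decides. A smaller value to its left rules out the maximal
      coordinate, so it is outside \<open>M\<close>; a smaller value to its right rules out 0, so it
      is in \<open>M\<close>.\<close>
    from \<open>u p \<noteq> u q\<close> consider "u p < u q" | "u q < u p" by linarith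
    then show ?thesis
    proof cases
      case 1
      then have "inversion_seq u (u q) \<noteq> u q - 1"
        unfolding inversion_seq_eq_max_iff using ge_1(1) less_asym[OF inv_less] by blast
      then have "u q \<notin> M" using max by blast
      then show ?thesis using 1 by (simp add: f_def)
    next
      case 2
      then have "inversion_seq u (u p) \<noteq> 0"
        unfolding inversion_seq_eq_0_iff using ge_1(2) inv_less[folded not_le] by blast
      then have "u p \<in> M" using zero[of "u p"] in_range(1) by (metis DiffI)
      then show ?thesis using 2 by (simp add: f_def)
    qed
  qed
  have "set (one_line n u) = u ` {1..n}"
    by (auto simp: one_line_def)
  then have set_u: "set (one_line n u) = {1..n}"
    using permutes_image[OF u] by simp
  have set_r: "set ?r = {1..n}" using finM M by auto
  have dist_u: "distinct (one_line n u)"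
    using permutes_inj[OF u] by (auto simp: one_line_def distinct_map intro: inj_on_subset)
  have dist_r: "distinct ?r" using finM by auto
  have "sorted_wrt (\<lambda>p q. f (u p) \<le> f (u q)) [1..<Suc n]"
    by (rule sorted_wrt_mono_rel[OF _ sorted_wrt_upt]) (rule less_imp_le, rule step, auto)
  then have sorted_u: "sorted (map f (one_line n u))"
    unfolding one_line_def map_map sorted_wrt_map comp_def .
  have "sorted_wrt (\<lambda>a b. b \<le> a) (rev (sorted_list_of_set M))"
    by (simp add: sorted_wrt_rev)
  then have "sorted (map f (rev (sorted_list_of_set M)))"
    unfolding sorted_wrt_map by (rule sorted_wrt_mono_rel[rotated]) (use finM in \<open>auto simp: f_def\<close>)
  moreover have "sorted (map f (sorted_list_of_set ({1..n} - M)))"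
    unfolding sorted_wrt_map
    by (rule sorted_wrt_mono_rel[OF _ sorted_sorted_list_of_set]) (auto simp: f_def)
  ultimately have sorted_r: "sorted (map f ?r)"
    using finM by (auto simp: sorted_append f_def)
  \<comment> \<open>Two lists with the same set of elements whose images under an injective key are
    sorted and distinct must coincide.\<close>
  have "distinct (map f (one_line n u))" "distinct (map f ?r)"
    unfolding distinct_map set_u set_r using inj dist_u dist_r by blast+
  moreover have "inj_on f (set (one_line n u) \<union> set ?r)"
    unfolding set_u set_r Un_absorb by (rule inj)
  ultimately show ?thesis
    using sorted_u sorted_r set_u set_r map_sorted_distinct_set_unique by metis
qed

text \<open>The right-to-left minima are the zeros of the inversion sequence of \<open>v\<close>;
  there the pseudocomplement has the maximal coordinate, elsewhere 0. So they serve as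
  \<open>M\<close>.\<close>

lemma one_line_pseudocomplement:
  assumes v: "v permutes {1..n}"
  shows "one_line n (pseudocomplement n v) =
    rev (sorted_list_of_set (rtl_minima n v)) @ sorted_list_of_set ({1..n} - rtl_minima n v)"
  using v
  by (intro one_line_of_extremal_inversion_seq pseudocomplement_permutes)
    (auto simp: rtl_minima_iff inversion_seq_pseudocomplement simp del: One_nat_def)

section \<open>Regular elements\<close>

lemma avoids_pseudocomplement:
  assumes v: "v permutes {1..n}"
  shows "avoids_132 n (pseudocomplement n v) \<and> avoids_231 n (pseudocomplement n v)"
  unfolding avoids_132_231_iff[OF pseudocomplement_permutes[OF v]]
  using v by (simp add: inversion_seq_pseudocomplement del: One_nat_def)

text \<open>A regular element is itself a pseudocomplement, hence has extremal coordinates.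
  Conversely, pseudocomplementation exchanges the extremal coordinates 0 and \<open>i - 1\<close>
  (equal when \<open>i = 1\<close>), so applying it twice restores them.\<close>

lemma regular_iff_avoids:
  assumes v: "v permutes {1..n}"
  shows "regular n v \<longleftrightarrow> avoids_132 n v \<and> avoids_231 n v"
proof
  assume "regular n v"
  then show "avoids_132 n v \<and> avoids_231 n v"
    using avoids_pseudocomplement[OF pseudocomplement_permutes[OF v]] by (simp add: regular_def)
next
  assume "avoids_132 n v \<and> avoids_231 n v"
  then have "inversion_seq v i \<in> {0, i - 1}" if "i \<in> {1..n}" for i
    using that avoids_132_231_iff[OF v] by blast
  then show "regular n v"
    unfolding regular_def using v
    by (intro inversion_seq_inject[of _ n] pseudocomplement_permutes)
      (fastforce simp: pseudocomplement_permutes inversion_seq_pseudocomplement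
        simp del: One_nat_def)+
qed

theorem theorem6p1:
  fixes n :: nat and v w :: "nat \<Rightarrow> nat"
  assumes "v permutes {1..n}" and "w permutes {1..n}"
  shows
    "greatest (middle_order n) (rel_pseudocomplement (middle_order n) v w)
       (rpc_set (middle_order n) v w)
     \<and> (\<forall>i\<in>{1..n}. inversion_seq (rel_pseudocomplement (middle_order n) v w) i =
          (if inversion_seq v i \<le> inversion_seq w i then i - 1 else inversion_seq w i))
     \<and> pseudocomplement n v permutes {1..n}
     \<and> one_line n (pseudocomplement n v) =
         rev (sorted_list_of_set (rtl_minima n v))
           @ sorted_list_of_set ({1..n} - rtl_minima n v)
     \<and> avoids_132 n (pseudocomplement n v) \<and> avoids_231 n (pseudocomplement n v)
     \<and> (regular n v \<longleftrightarrow> avoids_132 n v \<and> avoids_231 n v)"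
  using greatest_rel_pseudocomplement[OF assms(1)] inversion_seq_rel_pseudocomplement[OF assms(1)]
    pseudocomplement_permutes[OF assms(1)] one_line_pseudocomplement[OF assms(1)]
    avoids_pseudocomplement[OF assms(1)] regular_iff_avoids[OF assms(1)]
  by blast

end
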